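(* Let $Z_\infty$ be the planar piecewise smooth vector field equal to $X^+_\infty(x,y)=(1,2\pi\sin(2\pi x))$ for $y\ge 0$ and to $X^-_\infty(x,y)=(-1,2\pi\sin(2\pi x))$ for $y\le 0$, and let $\overline{\Omega}_\infty$, $\overline{T}_1$, $\overline{s}$ and $\sigma$ be as in the context, where $\overline{\Omega}_\infty$ and $\overline{s}(\overline{\Omega}_\infty)$ carry the cofinite topology. Then $\overline{s}:\overline{\Omega}_\infty\to\overline{s}(\overline{\Omega}_\infty)$ is a conjugacy between $\overline{T}_1$ and $\sigma$, i.e. $\overline{s}\circ\overline{T}_1=\sigma\circ\overline{s}$.
   Context: Let $P_\infty(x)=1-\cos(2\pi x)$, $p_j=j$ for $j\in\mathbb{Z}$, and $\Lambda_\infty=\{(x,P_\infty(x)):x\in\mathbb{R}\}\cup\{(x,-P_\infty(x)):x\in\mathbb{R}\}$. Here $\Omega_\infty$ is the set of global trajectories $\gamma:\mathbb{R}\to\Lambda_\infty$ of $Z_\infty$: continuous maps which follow the flow of $X_\infty^+$ where $y>0$, the flow of $X^-_\infty$ where $y<0$, and which at each passage through a point $(p_j,0)$ (a tangency point of both fields with $\{y=0\}$) may arrive along and leave along either the orbit of $X^+_\infty$ or the orbit of $X^-_\infty$. Put $I_{2j}=\{(x,P_\infty(x)):j<x<j+1\}$ and $I_{2j+1}=\{(x,-P_\infty(x)):j<x<j+1\}$, $j\in\mathbb{Z}$. The itinerary of $\gamma$ is $s(\gamma)=(s_j(\gamma))_{j\in\mathbb{Z}}$, where $s_j(\gamma)=n$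 if $\gamma(j)\in I_n$ and $s_j(\gamma)=m$ if $\gamma(j)$ is one of the points $(p_l,0)$ and $\gamma(j+\tfrac12)\in I_m$. Write $\gamma_1\sim\gamma_2$ iff $s(\gamma_1)=s(\gamma_2)$, and $\overline{\Omega}_\infty=\Omega_\infty/\sim$. $\overline{T}_1$ is the map on $\overline{\Omega}_\infty$ induced by $T_1(\gamma)(\cdot)=\gamma(\cdot+1)$; $\overline{s}$ is the map on $\overline{\Omega}_\infty$ induced by $s$; $\sigma$ is the left shift $\sigma((x_j)_{j\in\mathbb{Z}})=(x_{j+1})_{j\in\mathbb{Z}}$. A conjugacy is a homeomorphism satisfying the stated intertwining relation. *)

theory Defs
  imports "HOL-Analysis.Analysis"
begin

section \<open>Topological notions\<close>

definition cofinite_topology :: "'a set \<Rightarrow> 'a topology" where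
  "cofinite_topology A = topology (\<lambda>U. U = {} \<or> U \<subseteq> A \<and> finite (A - U))"

lemma openin_cofinite_topology:
  "openin (cofinite_topology A) U \<longleftrightarrow> U = {} \<or> U \<subseteq> A \<and> finite (A - U)"
proof -
  have "istopology (\<lambda>U. U = {} \<or> U \<subseteq> A \<and> finite (A - U))"
    unfolding istopology_def
  proof (intro conjI allI impI)
    fix S T assume "S = {} \<or> S \<subseteq> A \<and> finite (A - S)" "T = {} \<or> T \<subseteq> A \<and> finite (A - T)"
    then show "S \<inter> T = {} \<or> S \<inter> T \<subseteq> A \<and> finite (A - S \<inter> T)"
      by (auto simp: Diff_Int)
  next
    fix \<K> assume K: "\<forall>K\<in>\<K>. K = {} \<or> K \<subseteq> A \<and> finite (A - K)"
    show "\<Union>\<K> = {} \<or> \<Union>\<K> \<subseteq> A \<and> finite (A - \<Union>\<K>)"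
    proof (cases "\<Union>\<K> = {}")
      case False
      then obtain K where "K \<in> \<K>" "K \<noteq> {}" by blast
      with K have "finite (A - K)" by blast
      moreover have "A - \<Union>\<K> \<subseteq> A - K" using \<open>K \<in> \<K>\<close> by blast
      ultimately have "finite (A - \<Union>\<K>)" by (rule rev_finite_subset)
      with K show ?thesis by blast
    qed simp
  qed
  then show ?thesis by (simp add: cofinite_topology_def)
qed

lemma topspace_cofinite_topology [simp]: "topspace (cofinite_topology A) = A"
proof (rule subset_antisym)
  show "topspace (cofinite_topology A) \<subseteq> A"
    unfolding topspace_def openin_cofinite_topology by blast
  have "openin (cofinite_topology A) A"
    by (simp add: openin_cofinite_topology)
  then show "A \<subseteq> topspace (cofinite_topology A)"
    by (rule openin_subset)
qed

definition conjugacy ::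
  "'a topology \<Rightarrow> ('a \<Rightarrow> 'a) \<Rightarrow> 'b topology \<Rightarrow> ('b \<Rightarrow> 'b) \<Rightarrow> ('a \<Rightarrow> 'b) \<Rightarrow> bool" where
  "conjugacy X f Y g h \<longleftrightarrow>
     f \<in> topspace X \<rightarrow> topspace X \<and> g \<in> topspace Y \<rightarrow> topspace Y \<and>
     homeomorphic_map X Y h \<and> (\<forall>x\<in>topspace X. (h \<circ> f) x = (g \<circ> h) x)"


section \<open>Piecewise smooth planar vector fields and their trajectories\<close>

type_synonym planar_field = "real \<times> real \<Rightarrow> real \<times> real"

text \<open>A piecewise smooth field with switching line \<open>y = 0\<close> is the pair of a field for \<open>y \<ge> 0\<close>
  and a field for \<open>y \<le> 0\<close>; both components are active on the line itself.\<close>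

type_synonym piecewise_field = "planar_field \<times> planar_field"

definition integral_curve_on :: "planar_field \<Rightarrow> (real \<Rightarrow> real \<times> real) \<Rightarrow> real set \<Rightarrow> bool" where
  "integral_curve_on X \<gamma> S \<longleftrightarrow>
     (\<forall>t\<in>S. (\<gamma> has_vector_derivative X (\<gamma> t)) (at t within S))"

text \<open>At a tangency point \<open>(p j, 0)\<close> a trajectory arrives along an orbit of one of the two fields and
  leaves along an orbit of one of them, the two choices being independent. In particular it does
  not rest there.\<close>

definition global_trajectories ::
  "piecewise_field \<Rightarrow> (real \<times> real) set \<Rightarrow> (int \<Rightarrow> real) \<Rightarrow> (real \<Rightarrow> real \<times> real) set" where
  "global_trajectories Z \<Lambda> p = {\<gamma>.
     continuous_on UNIV \<gamma> \<and> range \<gamma> \<subseteq> \<Lambda> \<and>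
     (\<forall>t. snd (\<gamma> t) > 0 \<longrightarrow> (\<gamma> has_vector_derivative fst Z (\<gamma> t)) (at t)) \<and>
     (\<forall>t. snd (\<gamma> t) < 0 \<longrightarrow> (\<gamma> has_vector_derivative snd Z (\<gamma> t)) (at t)) \<and>
     (\<forall>t j. \<gamma> t = (p j, 0) \<longrightarrow>
        (\<exists>X\<in>{fst Z, snd Z}. \<exists>\<epsilon>>0. integral_curve_on X \<gamma> {t - \<epsilon>..t}) \<and>
        (\<exists>X\<in>{fst Z, snd Z}. \<exists>\<epsilon>>0. integral_curve_on X \<gamma> {t..t + \<epsilon>}))}"


section \<open>The system \<open>Z\<^sub>\<infinity>\<close>\<close>

definition X_plus :: planar_field where
  "X_plus = (\<lambda>(x, y). (1, 2 * pi * sin (2 * pi * x)))"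

definition X_minus :: planar_field where
  "X_minus = (\<lambda>(x, y). (-1, 2 * pi * sin (2 * pi * x)))"

definition Z_inf :: piecewise_field where
  "Z_inf = (X_plus, X_minus)"

definition P_inf :: "real \<Rightarrow> real" where
  "P_inf x = 1 - cos (2 * pi * x)"

definition p_inf :: "int \<Rightarrow> real" where
  "p_inf j = of_int j"

definition Lambda_inf :: "(real \<times> real) set" where
  "Lambda_inf = {(x, P_inf x) |x. True} \<union> {(x, - P_inf x) |x. True}"

definition Omega_inf :: "(real \<Rightarrow> real \<times> real) set" where
  "Omega_inf = global_trajectories Z_inf Lambda_inf p_inf"


section \<open>Itineraries\<close>

text \<open>With \<open>j = n div 2\<close> (rounded down, also for negative \<open>n\<close>), arc \<open>n = 2 * j\<close> is the upper and
  arc \<open>n = 2 * j + 1\<close> the lower open arc between \<open>(j, 0)\<close> and \<open>(j + 1, 0)\<close>.\<close>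

definition arc_inf :: "int \<Rightarrow> (real \<times> real) set" where
  "arc_inf n =
     (if even n then {(x, P_inf x) |x. of_int (n div 2) < x \<and> x < of_int (n div 2) + 1}
      else {(x, - P_inf x) |x. of_int (n div 2) < x \<and> x < of_int (n div 2) + 1})"

definition itinerary :: "(real \<Rightarrow> real \<times> real) \<Rightarrow> int \<Rightarrow> int" where
  "itinerary \<gamma> j =
     (if \<exists>l. \<gamma> (of_int j) = (p_inf l, 0) then THE m. \<gamma> (of_int j + 1/2) \<in> arc_inf m
      else THE n. \<gamma> (of_int j) \<in> arc_inf n)"

lemma arc_inf_disjoint:
  assumes "v \<in> arc_inf m" "v \<in> arc_inf n"
  shows "m = n"
proof -
  obtain x y where v: "v = (x, y)" by force
  have rng: "of_int (m div 2) < x" "x < of_int (m div 2) + 1"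
      "of_int (n div 2) < x" "x < of_int (n div 2) + 1"
    using assms unfolding v arc_inf_def by (auto split: if_splits)
  then have d: "m div 2 = n div 2" by linarith
  have "cos (2 * pi * x) \<noteq> 1"
  proof
    assume "cos (2 * pi * x) = 1"
    then obtain k :: int where "2 * pi * x = of_int k * 2 * pi"
      using cos_one_2pi_int by blast
    then have "x = of_int k" by simp
    with rng(1,2) have "real_of_int (m div 2) < of_int k" "real_of_int k < of_int (m div 2 + 1)"
      by simp_all
    then show False unfolding of_int_less_iff by simp
  qed
  then have P: "P_inf x > 0"
    unfolding P_inf_def using cos_le_one[of "2 * pi * x"] by linarith
  have "even m \<longleftrightarrow> even n"
    using assms P unfolding v arc_inf_def by (auto split: if_splits)
  with d show ?thesis by presburger
qed

lemma itinerary_eqI_arc: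
  assumes "\<gamma> (of_int j) \<in> arc_inf n"
  shows "itinerary \<gamma> j = n"
proof -
  have "\<gamma> (of_int j) \<noteq> (p_inf l, 0)" for l
    using assms by (auto simp: arc_inf_def p_inf_def split: if_splits)
  moreover have "(THE n. \<gamma> (of_int j) \<in> arc_inf n) = n"
    by (rule the_equality[where P = "\<lambda>n. \<gamma> (of_int j) \<in> arc_inf n"])
      (rule assms, rule arc_inf_disjoint[OF _ assms])
  ultimately show ?thesis by (simp add: itinerary_def)
qed

lemma itinerary_eqI_tangency:
  assumes "\<gamma> (of_int j) = (p_inf l, 0)" "\<gamma> (of_int j + 1/2) \<in> arc_inf m"
  shows "itinerary \<gamma> j = m"
proof -
  have "(THE m. \<gamma> (of_int j + 1/2) \<in> arc_inf m) = m"
    by (rule the_equality[where P = "\<lambda>m. \<gamma> (of_int j + 1/2) \<in> arc_inf m"])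
      (rule assms(2), rule arc_inf_disjoint[OF _ assms(2)])
  moreover have "\<exists>l. \<gamma> (of_int j) = (p_inf l, 0)" using assms(1) by blast
  ultimately show ?thesis by (simp only: itinerary_def if_True)
qed


section \<open>The quotient and the induced maps\<close>

definition itinerary_rel :: "((real \<Rightarrow> real \<times> real) \<times> (real \<Rightarrow> real \<times> real)) set" where
  "itinerary_rel = {(\<gamma>\<^sub>1, \<gamma>\<^sub>2). \<gamma>\<^sub>1 \<in> Omega_inf \<and> \<gamma>\<^sub>2 \<in> Omega_inf \<and> itinerary \<gamma>\<^sub>1 = itinerary \<gamma>\<^sub>2}"

definition Omega_bar :: "(real \<Rightarrow> real \<times> real) set set" where
  "Omega_bar = Omega_inf // itinerary_rel"

definition T1 :: "(real \<Rightarrow> real \<times> real) \<Rightarrow> real \<Rightarrow> real \<times> real" where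
  "T1 \<gamma> = (\<lambda>t. \<gamma> (t + 1))"

text \<open>Since \<open>T1\<close> preserves \<open>Omega_inf\<close> and respects the relation, all members of a class \<open>C\<close>
  contribute the same class to the union. If they contributed different ones, the value would not
  be an element of \<open>Omega_bar\<close>.\<close>

definition T1_bar :: "(real \<Rightarrow> real \<times> real) set \<Rightarrow> (real \<Rightarrow> real \<times> real) set" where
  "T1_bar C = (\<Union>\<gamma>\<in>C. itinerary_rel `` {T1 \<gamma>})"

definition s_bar :: "(real \<Rightarrow> real \<times> real) set \<Rightarrow> int \<Rightarrow> int" where
  "s_bar C = the_elem (itinerary ` C)"

definition left_shift :: "(int \<Rightarrow> 'a) \<Rightarrow> int \<Rightarrow> 'a" where
  "left_shift x = (\<lambda>j. x (j + 1))"

end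

theory Submission
  imports Defs
begin

text \<open>The relation on trajectories is the kernel of \<open>itinerary\<close>, so
  \<open>s_bar\<close> is well defined and injective on \<open>Omega_bar\<close>
  (\<open>inj_on_s_bar\<close>), hence a bijection onto its image. In the cofinite topology the open
  sets depend only on which subsets are finite, and bijections preserve finiteness both ways, so
  every bijection is a homeomorphism (\<open>homeomorphic_map_cofinite\<close>). For the
  intertwining relation, the fields are autonomous, so a time translate of a trajectory is again a
  trajectory (\<open>global_trajectories_translate\<close>). Translation by 1 carries the sampling
  times of index \<open>j\<close> to those of \<open>j + 1\<close>, which turns \<open>T1\<close>
  into the shift of itineraries (\<open>itinerary_T1\<close>); this passes to the quotient through
  representatives.\<close>

lemma homeomorphic_map_cofinite:
  assumes "bij_betw h A B"
  shows "homeomorphic_map (cofinite_topology A) (cofinite_topology B) h"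
proof (rule bijective_open_imp_homeomorphic_map)
  have inj: "inj_on h A" and im: "h ` A = B"
    using assms by (auto simp: bij_betw_def)
  show "continuous_map (cofinite_topology A) (cofinite_topology B) h"
  proof (unfold continuous_map_def topspace_cofinite_topology, intro conjI allI impI)
    show "h \<in> A \<rightarrow> B" using im by auto
    fix U assume U: "openin (cofinite_topology B) U"
    show "openin (cofinite_topology A) {x \<in> A. h x \<in> U}"
    proof (cases "U = {}")
      case True
      then show ?thesis by simp
    next
      case False
      then have "finite (B - U)" using U by (simp add: openin_cofinite_topology)
      \<comment> \<open>Injectivity of \<open>h\<close> lets finiteness be pulled back from this
        image to the complement of the preimage.\<close>
      moreover have "h ` (A - {x \<in> A. h x \<in> U}) \<subseteq> B - U" using im by auto
      ultimately have "finite (h ` (A - {x \<in> A. h x \<in> U}))" by (rule rev_finite_subset)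
      then have "finite (A - {x \<in> A. h x \<in> U})"
        by (rule finite_imageD) (rule inj_on_subset[OF inj Diff_subset])
      then show ?thesis by (auto simp: openin_cofinite_topology)
    qed
  qed
  show "open_map (cofinite_topology A) (cofinite_topology B) h"
  proof (unfold open_map_def, intro allI impI)
    fix U assume U: "openin (cofinite_topology A) U"
    show "openin (cofinite_topology B) (h ` U)"
    proof (cases "U = {}")
      case True
      then show ?thesis by simp
    next
      case False
      then have *: "U \<subseteq> A" "finite (A - U)"
        using U by (auto simp: openin_cofinite_topology)
      have "B - h ` U \<subseteq> h ` (A - U)" using im by auto
      with * have "finite (B - h ` U)" by (meson finite_imageI finite_subset)
      with * im show ?thesis by (auto simp: openin_cofinite_topology)
    qed
  qed
  show "h ` topspace (cofinite_topology A) = topspace (cofinite_topology B)"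
    using im by simp
  show "inj_on h (topspace (cofinite_topology A))"
    using inj by simp
qed

text \<open>Chain rule with inner derivative 1. The set \<open>S\<close> serves both the two-sided
  derivatives off the switching line and the one-sided ones at endpoints of arrival and departure
  intervals.\<close>

lemma has_vector_derivative_translate:
  fixes \<gamma> :: "real \<Rightarrow> 'a::real_normed_vector"
  assumes "(\<gamma> has_vector_derivative v) (at (t + c) within (\<lambda>u. u + c) ` S)"
  shows "((\<lambda>u. \<gamma> (u + c)) has_vector_derivative v) (at t within S)"
proof -
  have "((\<lambda>u. u + c) has_vector_derivative 1) (at t within S)"
    by (auto intro!: derivative_eq_intros)
  from vector_diff_chain_within[OF this assms] show ?thesis
    by (simp add: o_def)
qed

lemma integral_curve_on_translate:
  assumes "integral_curve_on X \<gamma> ((\<lambda>u. u + c) ` S)"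
  shows "integral_curve_on X (\<lambda>u. \<gamma> (u + c)) S"
  using assms unfolding integral_curve_on_def
  by (blast intro: has_vector_derivative_translate)

text \<open>Every defining condition is required at all times alike, and the fields see time only
  through the position \<open>\<gamma> t\<close>; each condition at \<open>t\<close> is the old one
  at \<open>t + c\<close>, with the same field and the same \<epsilon>.\<close>

lemma global_trajectories_translate:
  assumes "\<gamma> \<in> global_trajectories Z \<Lambda> p"
  shows "(\<lambda>u. \<gamma> (u + c)) \<in> global_trajectories Z \<Lambda> p"
proof -
  have cont: "continuous_on UNIV \<gamma>" and rng: "range \<gamma> \<subseteq> \<Lambda>"
    and pos: "\<And>t. snd (\<gamma> t) > 0 \<Longrightarrow> (\<gamma> has_vector_derivative fst Z (\<gamma> t)) (at t)"
    and neg: "\<And>t. snd (\<gamma> t) < 0 \<Longrightarrow> (\<gamma> has_vector_derivative snd Z (\<gamma> t)) (at t)"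
    and tan: "\<And>t j. \<gamma> t = (p j, 0) \<Longrightarrow>
        (\<exists>X\<in>{fst Z, snd Z}. \<exists>\<epsilon>>0. integral_curve_on X \<gamma> {t - \<epsilon>..t}) \<and>
        (\<exists>X\<in>{fst Z, snd Z}. \<exists>\<epsilon>>0. integral_curve_on X \<gamma> {t..t + \<epsilon>})"
    using assms unfolding global_trajectories_def by auto
  have arrive: "integral_curve_on X (\<lambda>u. \<gamma> (u + c)) {t - \<epsilon>..t}"
    if "integral_curve_on X \<gamma> {t + c - \<epsilon>..t + c}" for X t \<epsilon>
    by (rule integral_curve_on_translate) (use that in \<open>simp add: algebra_simps\<close>)
  have leave: "integral_curve_on X (\<lambda>u. \<gamma> (u + c)) {t..t + \<epsilon>}"
    if "integral_curve_on X \<gamma> {t + c..t + c + \<epsilon>}" for X t \<epsilon>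
    by (rule integral_curve_on_translate) (use that in \<open>simp add: algebra_simps\<close>)
  have "continuous_on UNIV (\<lambda>u. \<gamma> (u + c))"
    by (rule continuous_on_compose2[OF cont]) (auto intro: continuous_intros)
  moreover have "range (\<lambda>u. \<gamma> (u + c)) \<subseteq> \<Lambda>" using rng by auto
  moreover have "((\<lambda>u. \<gamma> (u + c)) has_vector_derivative fst Z (\<gamma> (t + c))) (at t)"
    if "snd (\<gamma> (t + c)) > 0" for t
    by (rule has_vector_derivative_translate)
      (rule has_vector_derivative_at_within[OF pos[OF that]])
  moreover have "((\<lambda>u. \<gamma> (u + c)) has_vector_derivative snd Z (\<gamma> (t + c))) (at t)"
    if "snd (\<gamma> (t + c)) < 0" for t
    by (rule has_vector_derivative_translate)
      (rule has_vector_derivative_at_within[OF neg[OF that]])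
  moreover have "(\<exists>X\<in>{fst Z, snd Z}. \<exists>\<epsilon>>0. integral_curve_on X (\<lambda>u. \<gamma> (u + c)) {t - \<epsilon>..t}) \<and>
        (\<exists>X\<in>{fst Z, snd Z}. \<exists>\<epsilon>>0. integral_curve_on X (\<lambda>u. \<gamma> (u + c)) {t..t + \<epsilon>})"
    if "\<gamma> (t + c) = (p j, 0)" for t j
    using tan[OF that] by (blast intro: arrive leave)
  ultimately show ?thesis
    unfolding global_trajectories_def mem_Collect_eq by iprover
qed

lemma T1_in_Omega_inf: "\<gamma> \<in> Omega_inf \<Longrightarrow> T1 \<gamma> \<in> Omega_inf"
  unfolding Omega_inf_def T1_def by (rule global_trajectories_translate)

text \<open>Both sides unfold to the same descriptions at times \<open>j + 1\<close> and
  \<open>j + 1 + 1/2\<close>, so equality holds for arbitrary \<gamma>, even where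
  \<open>THE\<close> has no unique witness.\<close>

lemma itinerary_T1: "itinerary (T1 \<gamma>) = left_shift (itinerary \<gamma>)"
  by (rule ext) (simp add: itinerary_def left_shift_def T1_def add_ac)

lemma equiv_itinerary_rel: "equiv Omega_inf itinerary_rel"
  unfolding itinerary_rel_def
  by (rule equivI) (auto simp: refl_on_def sym_def trans_def)

lemma Omega_barE:
  assumes "C \<in> Omega_bar"
  obtains \<gamma> where "\<gamma> \<in> Omega_inf" "C = itinerary_rel `` {\<gamma>}"
  using assms unfolding Omega_bar_def by (rule quotientE)

text \<open>Itineraries are constant on a class, and the class is nonempty since it contains
  \<gamma>; so \<open>the_elem\<close> is applied to a singleton.\<close>

lemma s_bar_class:
  assumes "\<gamma> \<in> Omega_inf"
  shows "s_bar (itinerary_rel `` {\<gamma>}) = itinerary \<gamma>"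
proof -
  have "itinerary ` (itinerary_rel `` {\<gamma>}) = {itinerary \<gamma>}"
    using assms by (auto simp: itinerary_rel_def)
  then show ?thesis by (simp add: s_bar_def)
qed

text \<open>By \<open>itinerary_T1\<close>, equal itineraries stay equal after \<open>T1\<close>, so
  the union collapses to a single class.\<close>

lemma T1_bar_class:
  assumes "\<gamma> \<in> Omega_inf"
  shows "T1_bar (itinerary_rel `` {\<gamma>}) = itinerary_rel `` {T1 \<gamma>}"
  using assms by (auto simp: T1_bar_def itinerary_rel_def itinerary_T1 T1_in_Omega_inf)

lemma inj_on_s_bar: "inj_on s_bar Omega_bar"
proof (rule inj_onI)
  fix C D assume "C \<in> Omega_bar" "D \<in> Omega_bar" and eq: "s_bar C = s_bar D"
  obtain \<gamma> where C: "\<gamma> \<in> Omega_inf" "C = itinerary_rel `` {\<gamma>}"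
    using \<open>C \<in> Omega_bar\<close> by (rule Omega_barE)
  obtain \<delta> where D: "\<delta> \<in> Omega_inf" "D = itinerary_rel `` {\<delta>}"
    using \<open>D \<in> Omega_bar\<close> by (rule Omega_barE)
  have "itinerary \<gamma> = itinerary \<delta>"
    using eq by (simp add: C D s_bar_class)
  with C D have "(\<gamma>, \<delta>) \<in> itinerary_rel"
    by (simp add: itinerary_rel_def)
  then have "itinerary_rel `` {\<gamma>} = itinerary_rel `` {\<delta>}"
    by (rule equiv_class_eq[OF equiv_itinerary_rel])
  with C D show "C = D" by simp
qed

theorem proposition9:
  shows "conjugacy (cofinite_topology Omega_bar) T1_bar
           (cofinite_topology (s_bar ` Omega_bar)) left_shift s_bar"
proof -
  have step: "T1_bar C \<in> Omega_bar \<and> s_bar (T1_bar C) = left_shift (s_bar C)"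
    if C: "C \<in> Omega_bar" for C
  proof -
    obtain \<gamma> where "\<gamma> \<in> Omega_inf" "C = itinerary_rel `` {\<gamma>}"
      using C by (rule Omega_barE)
    then show ?thesis
      by (simp add: T1_bar_class s_bar_class T1_in_Omega_inf itinerary_T1 Omega_bar_def quotientI)
  qed
  \<comment> \<open>A conjugacy needs the shift to map the set of itineraries into itself; the
    intertwining relation supplies \<open>T1_bar C\<close> as preimage.\<close>
  have "left_shift (s_bar C) \<in> s_bar ` Omega_bar" if "C \<in> Omega_bar" for C
    using step[OF that] by (intro image_eqI[where x = "T1_bar C"]) simp_all
  moreover have "homeomorphic_map (cofinite_topology Omega_bar)
      (cofinite_topology (s_bar ` Omega_bar)) s_bar"
    by (rule homeomorphic_map_cofinite) (rule inj_on_imp_bij_betw[OF inj_on_s_bar])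
  ultimately show ?thesis
    using step by (auto simp: conjugacy_def)
qed

end
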